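(* Let $R(\mathbf{u}_S)=\|\mathcal{R}_\theta(\mathbf{u}_S)\|_2^2$ and $\bar J_\mu(\mathbf{u}_S):=\bar J_{NO}(\mathbf{u}_S)+\mu R(\mathbf{u}_S)$. Fix $\mathbf{u}_S\in\mathbb{R}^N$ and set $\mathbf{g}:=\nabla_{\mathbf{u}}\bar J_{NO}(\mathbf{u}_S)$, $\mathbf{r}:=\nabla_{\mathbf{u}}R(\mathbf{u}_S)$. Suppose $\mathbf{d}\in\mathbb{R}^N$ is a cheating direction at $\mathbf{u}_S$, i.e. $\mathbf{d}^\top\mathbf{g}<0$ and $\mathbf{d}^\top\mathbf{r}>0$. Then the threshold $$\mu^*:=\frac{-\mathbf{g}^\top\mathbf{d}}{\mathbf{r}^\top\mathbf{d}}$$ satisfies $\mu^*>0$, and for all $\mu>\mu^*$, $$\big(\nabla_{\mathbf{u}}\bar J_\mu(\mathbf{u}_S)\big)^\top\mathbf{d}=\mathbf{g}^\top\mathbf{d}+\mu\,\mathbf{r}^\top\mathbf{d}>0.$$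
   Context: Setting. A control is a vector $\mathbf{u}_S\in\mathbb{R}^{N}$, $N=n_u m$, consisting of the stacked values of an $\mathbb{R}^{n_u}$-valued control function at $m$ fixed sensor points $\mathbf{s}_1,\dots,\mathbf{s}_m$. A trained neural operator with fixed parameters $\theta$ is a map $\mathcal{G}_\theta$ sending $\mathbf{u}_S$ to the stacked state values $(\mathcal{G}_\theta(\mathbf{u}_S)(\mathbf{s}_j))_{j=1}^m\in\mathbb{R}^{n_y m}$. The tracking objective is $$\bar J_{NO}(\mathbf{u}_S)=\sum_{j=1}^m\|\mathcal{G}_\theta(\mathbf{u}_S)(\mathbf{s}_j)-\mathbf{y}_d(\mathbf{s}_j)\|_2^2\,w_j+\lambda\|\mathbf{u}_S\|_{\mathcal{U}_h}^2,$$ where $\mathbf{y}_d(\mathbf{s}_j)\in\mathbb{R}^{n_y}$ are given targets, $w_j$ are quadrature weights, $\lambda\ge 0$, and $\|\cdot\|_{\mathcal{U}_h}$ is a norm (or seminorm) on $\mathbb{R}^N$ induced by a (semi-)inner product. $\mathcal{R}_\theta:\mathbb{R}^N\to\mathbb{R}^M$ is the vector of residuals of a differential equation (with boundary and initial conditions absorbed) evaluated through the neural operator; the only property of it used is that it is a differentiable map. Standing assumption: $\mathcal{G}_\theta$, $\bar J_{NO}$ and $\mathcal{R}_\theta$ are differentiable with respect to $\mathbf{u}_S$. *)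

theory Defs
  imports "HOL-Analysis.Analysis"
begin

text \<open>The definite description denotes the gradient only where the function is differentiable;
  see \<open>GDERIV_grad\<close> below.\<close>

definition grad :: "('a::euclidean_space \<Rightarrow> real) \<Rightarrow> 'a \<Rightarrow> 'a" where
  "grad f x = (THE D. GDERIV f x :> D)"

lemma GDERIV_unique:
  fixes f :: "'a::euclidean_space \<Rightarrow> real"
  assumes "GDERIV f x :> D" "GDERIV f x :> E"
  shows "D = E"
proof -
  have "(\<lambda>h. h \<bullet> D) = (\<lambda>h. h \<bullet> E)"
    using assms unfolding gderiv_def by (rule has_derivative_unique)
  then have "h \<bullet> D = h \<bullet> E" for h by (rule fun_cong)
  then show ?thesis using vector_eq_rdot[of D E] by (simp add: inner_commute)
qed

lemma GDERIV_grad: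
  fixes f :: "'a::euclidean_space \<Rightarrow> real"
  assumes "f differentiable (at x)"
  shows "GDERIV f x :> grad f x"
proof -
  obtain f' where f': "(f has_derivative f') (at x)"
    using assms by (auto simp: differentiable_def)
  then have "linear f'" by (rule has_derivative_linear)
  have "f' h = h \<bullet> adjoint f' 1" for h
    using adjoint_works[OF \<open>linear f'\<close>, of h 1] by simp
  then have "f' = (\<lambda>h. h \<bullet> adjoint f' 1)" by (rule ext)
  with f' have D: "GDERIV f x :> adjoint f' 1"
    unfolding gderiv_def by (rule has_derivative_eq_rhs)
  show ?thesis
    unfolding grad_def by (rule theI[where P = "\<lambda>D. GDERIV f x :> D", OF D]) (rule GDERIV_unique[OF _ D])
qed

definition semi_inner_product :: "('a::real_vector \<Rightarrow> 'a \<Rightarrow> real) \<Rightarrow> bool" where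
  "semi_inner_product B \<longleftrightarrow>
     bilinear B \<and> (\<forall>x y. B x y = B y x) \<and> (\<forall>x. 0 \<le> B x x)"

definition induced_seminorm :: "('a::real_vector \<Rightarrow> 'a \<Rightarrow> real) \<Rightarrow> 'a \<Rightarrow> real" where
  "induced_seminorm B x = sqrt (B x x)"

text \<open>With \<open>'m\<close> indexing the sensor points, a stack of \<open>m\<close> vectors of \<open>\<real>\<^sup>n\<close> is a vector of
  \<open>\<real>\<^bsup>n m\<^esup>\<close> indexed by \<open>'m \<times> 'n\<close>: the entry \<open>(j, i)\<close> is the component \<open>i\<close> at the sensor \<open>j\<close>.
  In particular the controls live in \<open>real ^ ('m \<times> 'nu)\<close>, of dimension \<open>N = n\<^sub>u m\<close>.\<close>

definition stacked :: "('m::finite \<Rightarrow> 'x) \<Rightarrow> ('x \<Rightarrow> real ^ 'n::finite) \<Rightarrow> real ^ ('m \<times> 'n)" where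
  "stacked s y = (\<chi> p. y (s (fst p)) $ snd p)"

definition tracking_objective ::
  "('m::finite \<Rightarrow> 'x) \<Rightarrow> ('m \<Rightarrow> real) \<Rightarrow> ('x \<Rightarrow> real ^ 'ny) \<Rightarrow> real \<Rightarrow>
   (real ^ ('m \<times> 'nu::finite) \<Rightarrow> real ^ ('m \<times> 'nu) \<Rightarrow> real) \<Rightarrow>
   (real ^ ('m \<times> 'nu) \<Rightarrow> 'x \<Rightarrow> real ^ 'ny) \<Rightarrow> real ^ ('m \<times> 'nu) \<Rightarrow> real" where
  "tracking_objective s w y\<^sub>d lam B G u =
     (\<Sum>j\<in>UNIV. (norm (G u (s j) - y\<^sub>d (s j)))\<^sup>2 * w j) + lam * (induced_seminorm B u)\<^sup>2"

definition residual_penalty :: "('a \<Rightarrow> real ^ 'M) \<Rightarrow> 'a \<Rightarrow> real" where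
  "residual_penalty Res u = (norm (Res u))\<^sup>2"

definition penalized :: "('a \<Rightarrow> real) \<Rightarrow> ('a \<Rightarrow> real) \<Rightarrow> real \<Rightarrow> 'a \<Rightarrow> real" where
  "penalized J R \<mu> u = J u + \<mu> * R u"

definition cheating_direction ::
  "('a::euclidean_space \<Rightarrow> real) \<Rightarrow> ('a \<Rightarrow> real) \<Rightarrow> 'a \<Rightarrow> 'a \<Rightarrow> bool" where
  "cheating_direction J R u d \<longleftrightarrow> d \<bullet> grad J u < 0 \<and> d \<bullet> grad R u > 0"

end

theory Submission
  imports Defs
begin

text \<open>Taking gradients is linear, so the slope of \<open>penalized J R \<mu>\<close> at
  \<open>u\<close> along \<open>d\<close> is the affine function
  \<open>g \<bullet> d + \<mu> * (r \<bullet> d)\<close> of \<mu>. A cheating direction makes its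
  intercept negative and its coefficient positive, so its unique zero \<open>\<mu>s\<close> is
  positive and the slope is positive beyond it. \<open>grad_penalized\<close> supplies the affine
  formula; \<open>residual_penalty_differentiable\<close> ensures that \<open>grad R u\<close> is a
  genuine gradient.\<close>

text \<open>Makes the definite description computable: by uniqueness, exhibiting one gradient
  determines \<open>grad\<close>.\<close>

lemma GDERIV_imp_grad_eq:
  fixes f :: "'a::euclidean_space \<Rightarrow> real"
  assumes "GDERIV f x :> D"
  shows "grad f x = D"
  unfolding grad_def using assms by (blast intro: the_equality GDERIV_unique)

lemma grad_penalized:
  fixes J R :: "'a::euclidean_space \<Rightarrow> real"
  assumes "J differentiable (at x)" "R differentiable (at x)"
  shows "grad (penalized J R \<mu>) x = grad J x + \<mu> *\<^sub>R grad R x"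
proof (rule GDERIV_imp_grad_eq)
  \<comment> \<open>The derivative is kept as a sum of two inner products, the shape the derivative
    rules produce; bilinearity then merges them into a single inner product with
    \<open>h\<close>.\<close>
  have "((\<lambda>v. J v + \<mu> * R v) has_derivative
      (\<lambda>h. h \<bullet> grad J x + \<mu> * (h \<bullet> grad R x))) (at x)"
    using assms[THEN GDERIV_grad] unfolding gderiv_def
    by (intro has_derivative_add has_derivative_mult_right)
  then show "GDERIV (penalized J R \<mu>) x :> grad J x + \<mu> *\<^sub>R grad R x"
    by (simp add: gderiv_def penalized_def[abs_def] inner_add_right)
qed

lemma residual_penalty_differentiable:
  fixes Res :: "'a::real_normed_vector \<Rightarrow> real ^ 'M"
  assumes "Res differentiable (at x)"
  shows "residual_penalty Res differentiable (at x)"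
proof -
  obtain D where "(Res has_derivative D) (at x)"
    using assms by (auto simp: differentiable_def)
  \<comment> \<open>The squared norm is \<open>Res v \<bullet> Res v\<close>, so the product rule
    applies with the same derivative \<open>D\<close> in both factors; this avoids the norm, which
    is not differentiable at zero.\<close>
  from has_derivative_inner[OF this this] show ?thesis
    unfolding residual_penalty_def[abs_def] power2_norm_eq_inner
    by (rule differentiableI)
qed

theorem corollary3p8:
  fixes s :: "'m::finite \<Rightarrow> 'x"
    and w :: "'m \<Rightarrow> real"
    and y\<^sub>d :: "'x \<Rightarrow> real ^ 'ny::finite"
    and lam :: real
    and B :: "real ^ ('m \<times> 'nu::finite) \<Rightarrow> real ^ ('m \<times> 'nu) \<Rightarrow> real"
    and G :: "real ^ ('m \<times> 'nu) \<Rightarrow> 'x \<Rightarrow> real ^ 'ny"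
    and Res :: "real ^ ('m \<times> 'nu) \<Rightarrow> real ^ 'M"
    and J R :: "real ^ ('m \<times> 'nu) \<Rightarrow> real"
    and u g r d :: "real ^ ('m \<times> 'nu)"
    and \<mu>s :: real
  assumes "lam \<ge> 0"
    and "semi_inner_product B"
    and J: "J = tracking_objective s w y\<^sub>d lam B G"
    and R: "R = residual_penalty Res"
    and "\<And>v. (\<lambda>v. stacked s (G v)) differentiable (at v)"
    and "\<And>v. J differentiable (at v)"
    and "\<And>v. Res differentiable (at v)"
    and g: "g = grad J u"
    and r: "r = grad R u"
    and "cheating_direction J R u d"
    and \<mu>s: "\<mu>s = (- (g \<bullet> d)) / (r \<bullet> d)"
  shows "\<mu>s > 0 \<and>
    (\<forall>\<mu>>\<mu>s. grad (penalized J R \<mu>) u \<bullet> d = g \<bullet> d + \<mu> * (r \<bullet> d) \<and>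
            g \<bullet> d + \<mu> * (r \<bullet> d) > 0)"
proof -
  have neg: "g \<bullet> d < 0" and pos: "r \<bullet> d > 0"
    using \<open>cheating_direction J R u d\<close>
    by (simp_all add: cheating_direction_def g r inner_commute)
  have "R differentiable (at u)"
    unfolding R using assms(7) by (rule residual_penalty_differentiable)
  then have "grad (penalized J R \<mu>) u \<bullet> d = g \<bullet> d + \<mu> * (r \<bullet> d)" for \<mu>
    using assms(6) by (simp add: grad_penalized g r inner_add_left)
  moreover have "g \<bullet> d + \<mu> * (r \<bullet> d) > 0" if "\<mu> > \<mu>s" for \<mu>
    \<comment> \<open>Clearing the positive denominator turns \<open>\<mu> > \<mu>s\<close> into
      \<open>- (g \<bullet> d) < \<mu> * (r \<bullet> d)\<close>, which is linear once the product
      is treated as an atom.\<close>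
    using that pos unfolding \<mu>s pos_divide_less_eq[OF pos] by linarith
  moreover have "\<mu>s > 0"
    using neg pos by (simp add: \<mu>s divide_neg_pos)
  ultimately show ?thesis by blast
qed

end
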